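(* The tensor commutation matrix $U_{2\otimes 3}$ is expressed in terms of the Pauli matrices $\sigma_1,\sigma_2,\sigma_3$ and the Gell-Mann matrices $\lambda_1,\ldots,\lambda_8$ by $$\begin{aligned} U_{2\otimes 3}={}&\left(\tfrac12 I_2+\tfrac12\sigma_3\right)\otimes\left(\tfrac13 I_3+\tfrac12\lambda_3+\tfrac{\sqrt3}{6}\lambda_8\right) +\left(\tfrac12\sigma_1+\tfrac{i}{2}\sigma_2\right)\otimes\left(\tfrac12\lambda_1-\tfrac{i}{2}\lambda_2\right)\\ &+\left(\tfrac12 I_2+\tfrac12\sigma_3\right)\otimes\left(\tfrac12\lambda_6-\tfrac{i}{2}\lambda_7\right) +\left(\tfrac12 I_2-\tfrac12\sigma_3\right)\otimes\left(\tfrac12\lambda_1+\tfrac{i}{2}\lambda_2\right)\\ &+\left(\tfrac12\sigma_1-\tfrac{i}{2}\sigma_2\right)\otimes\left(\tfrac12\lambda_6+\tfrac{i}{2}\lambda_7\right) +\left(\tfrac12 I_2-\tfrac12\sigma_3\right)\otimes\left(\tfrac13 I_3-\tfrac{\sqrt3}{3}\lambda_8\right). \end{aligned}$$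
   Context: $\mathcal{M}_{m\times n}(\mathbb{C})$ denotes the set of $m\times n$ complex matrices, $I_n$ is the $n\times n$ identity matrix, and $i$ is the imaginary unit. For $A=(A^k_l)\in\mathcal{M}_{m\times n}(\mathbb{C})$ and $B\in\mathcal{M}_{p\times r}(\mathbb{C})$, the tensor product $A\otimes B\in\mathcal{M}_{mp\times nr}(\mathbb{C})$ is the Kronecker product, i.e. the block matrix whose $(k,l)$ block is $A^k_lB$. Matrices are identified when they agree as ordinary matrices after ignoring the block structure. For integers $p,q\geq 2$, the tensor commutation matrix $p\otimes q$ is the permutation matrix $U_{p\otimes q}\in\mathcal{M}_{pq\times pq}(\mathbb{C})$ (with entries 0 and 1) such that $U_{p\otimes q}\cdot(a\otimes b)=b\otimes a$ for all $a\in\mathcal{M}_{p\times 1}(\mathbb{C})$ and $b\in\mathcal{M}_{q\times 1}(\mathbb{C})$. Pauli matrices: $\sigma_1=\begin{pmatrix}0&1\\1&0\end{pmatrix}$, $\sigma_2=\begin{pmatrix}0&-i\\i&0\end{pmatrix}$, $\sigma_3=\begin{pmatrix}1&0\\0&-1\end{pmatrix}$. Gell-Mann matrices: $\lambda_1=\begin{pmatrix}0&1&0\\1&0&0\\0&0&0\end{pmatrix}$, $\lambda_2=\begin{pmatrix}0&-i&0\\i&0&0\\0&0&0\end{pmatrix}$, $\lambda_3=\begin{pmatrix}1&0&0\\0&-1&0\\0&0&0\end{pmatrix}$, $\lambda_4=\begin{pmatrix}0&0&1\\0&0&0\\1&0&0\end{pmatrix}$, $\lambda_5=\begin{pmatrix}0&0&-i\\0&0&0\\i&0&0\end{pmatrix}$,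 $\lambda_6=\begin{pmatrix}0&0&0\\0&0&1\\0&1&0\end{pmatrix}$, $\lambda_7=\begin{pmatrix}0&0&0\\0&0&-i\\0&i&0\end{pmatrix}$, $\lambda_8=\frac{1}{\sqrt3}\begin{pmatrix}1&0&0\\0&1&0\\0&0&-2\end{pmatrix}$. *)

theory Defs
  imports Jordan_Normal_Form.Matrix "HOL-Combinatorics.Permutations"
begin

(* The (k,l) block of the product is A $$ (k,l) times B, so row k*p + r corresponds to
   row k of A and row r of B (p = dim_row B), and likewise for columns. *)
definition kronecker :: "complex mat \<Rightarrow> complex mat \<Rightarrow> complex mat"  (infixr "\<otimes>\<^sub>k" 72) where
  "A \<otimes>\<^sub>k B = mat (dim_row A * dim_row B) (dim_col A * dim_col B)
     (\<lambda>(i, j). A $$ (i div dim_row B, j div dim_col B) * B $$ (i mod dim_row B, j mod dim_col B))"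

definition permutation_mat :: "nat \<Rightarrow> complex mat \<Rightarrow> bool" where
  "permutation_mat n P \<longleftrightarrow>
     (\<exists>\<pi>. \<pi> permutes {..<n} \<and> P = mat n n (\<lambda>(i, j). if i = \<pi> j then 1 else 0))"

definition is_tensor_commutation_mat :: "nat \<Rightarrow> nat \<Rightarrow> complex mat \<Rightarrow> bool" where
  "is_tensor_commutation_mat p q U \<longleftrightarrow>
     permutation_mat (p * q) U \<and>
     (\<forall>a \<in> carrier_mat p 1. \<forall>b \<in> carrier_mat q 1. U * (a \<otimes>\<^sub>k b) = b \<otimes>\<^sub>k a)"

(* The description is meaningful by ex1_tensor_commutation_mat below. *)
definition tensor_commutation_mat :: "nat \<Rightarrow> nat \<Rightarrow> complex mat" where
  "tensor_commutation_mat p q = (THE U. is_tensor_commutation_mat p q U)"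

lemma kronecker_col_index:
  assumes "a \<in> carrier_mat p 1" "b \<in> carrier_mat q 1" "k < p * q"
  shows "(a \<otimes>\<^sub>k b) $$ (k, 0) = a $$ (k div q, 0) * b $$ (k mod q, 0)"
  using assms by (auto simp: kronecker_def)

lemma kronecker_col_carrier:
  assumes "a \<in> carrier_mat p 1" "b \<in> carrier_mat q 1"
  shows "a \<otimes>\<^sub>k b \<in> carrier_mat (p * q) 1"
  using assms by (auto simp: kronecker_def)

lemma mult_col_index:
  fixes U v :: "complex mat"
  assumes "U \<in> carrier_mat n n" "v \<in> carrier_mat n 1" "r < n"
  shows "(U * v) $$ (r, 0) = (\<Sum>k<n. U $$ (r, k) * v $$ (k, 0))"
  using assms by (auto simp: scalar_prod_def lessThan_atLeast0 intro!: sum.cong)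

lemma tensor_index_less:
  fixes i j p q :: nat
  assumes "i < p" "j < q"
  shows "i * q + j < p * q"
proof -
  have "i * q + j < Suc i * q" using assms(2) by simp
  also have "\<dots> \<le> p * q" using assms(1) by (intro mult_le_mono1) simp
  finally show ?thesis .
qed

lemma exists_tensor_commutation_mat:
  assumes p: "p > 0" and q: "q > 0"
  shows "\<exists>U. is_tensor_commutation_mat p q U"
proof -
  define \<pi> where "\<pi> k = (if k < p * q then (k mod q) * p + k div q else k)" for k
  define \<rho> where "\<rho> r = (if r < p * q then (r mod p) * q + r div p else r)" for r
  have dq: "k div q < p" if "k < p * q" for k
    using that by (simp add: less_mult_imp_div_less)
  have dp: "r div p < q" if "r < p * q" for r
    using that by (metis less_mult_imp_div_less mult.commute)
  have lt: "\<pi> k < p * q" if "k < p * q" for k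
    using tensor_index_less[of "k mod q" q "k div q" p] dq[OF that] q that
    by (simp add: \<pi>_def mult.commute)
  have lt': "\<rho> r < p * q" if "r < p * q" for r
    using tensor_index_less[of "r mod p" p "r div p" q] dp[OF that] p that
    by (simp add: \<rho>_def)
  have inv1: "\<rho> (\<pi> k) = k" if "k < p * q" for k
    using lt[OF that] dq[OF that] that p by (simp add: \<rho>_def \<pi>_def)
  have inv2: "\<pi> (\<rho> r) = r" if "r < p * q" for r
    using lt'[OF that] dp[OF that] that q by (simp add: \<rho>_def \<pi>_def)
  have perm: "\<pi> permutes {..<p * q}"
  proof (rule bij_imp_permutes)
    show "bij_betw \<pi> {..<p * q} {..<p * q}"
      by (rule bij_betw_byWitness[where f' = \<rho>]) (use lt lt' inv1 inv2 in auto)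
  qed (simp add: \<pi>_def)
  define U :: "complex mat"
    where "U = mat (p * q) (p * q) (\<lambda>(i, j). if i = \<pi> j then 1 else 0)"
  have Uc: "U \<in> carrier_mat (p * q) (p * q)" by (simp add: U_def)
  have "U * (a \<otimes>\<^sub>k b) = b \<otimes>\<^sub>k a" if a: "a \<in> carrier_mat p 1" and b: "b \<in> carrier_mat q 1" for a b
  proof (rule eq_matI)
    note ab = kronecker_col_carrier[OF a b] and ba = kronecker_col_carrier[OF b a]
    show "dim_row (U * (a \<otimes>\<^sub>k b)) = dim_row (b \<otimes>\<^sub>k a)"
      "dim_col (U * (a \<otimes>\<^sub>k b)) = dim_col (b \<otimes>\<^sub>k a)" using Uc ab ba by auto
    fix r c assume "r < dim_row (b \<otimes>\<^sub>k a)" "c < dim_col (b \<otimes>\<^sub>k a)"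
    hence r: "r < p * q" and c: "c = 0" using ba by (auto simp: mult.commute)
    have "(U * (a \<otimes>\<^sub>k b)) $$ (r, 0) = (\<Sum>k<p * q. U $$ (r, k) * (a \<otimes>\<^sub>k b) $$ (k, 0))"
      by (rule mult_col_index[OF Uc ab r])
    also have "\<dots> = (\<Sum>k<p * q. if k = \<rho> r then (a \<otimes>\<^sub>k b) $$ (k, 0) else 0)"
    proof (rule sum.cong[OF refl])
      fix k assume "k \<in> {..<p * q}"
      hence k: "k < p * q" by simp
      have "r = \<pi> k \<longleftrightarrow> k = \<rho> r" using inv1[OF k] inv2[OF r] by metis
      thus "U $$ (r, k) * (a \<otimes>\<^sub>k b) $$ (k, 0) = (if k = \<rho> r then (a \<otimes>\<^sub>k b) $$ (k, 0) else 0)"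
        using k r by (simp add: U_def)
    qed
    also have "\<dots> = (a \<otimes>\<^sub>k b) $$ (\<rho> r, 0)" using lt'[OF r] by simp
    also have "\<dots> = a $$ (r mod p, 0) * b $$ (r div p, 0)"
      using kronecker_col_index[OF a b lt'[OF r]] dp[OF r] r q by (simp add: \<rho>_def)
    also have "\<dots> = (b \<otimes>\<^sub>k a) $$ (r, 0)"
      using kronecker_col_index[OF b a, of r] r by (simp add: mult.commute)
    finally show "(U * (a \<otimes>\<^sub>k b)) $$ (r, c) = (b \<otimes>\<^sub>k a) $$ (r, c)" using c by simp
  qed
  thus ?thesis
    using perm unfolding is_tensor_commutation_mat_def permutation_mat_def U_def by blast
qed

lemma tensor_commutation_mat_unique:
  assumes "is_tensor_commutation_mat p q U" "is_tensor_commutation_mat p q V"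
  shows "U = V"
proof -
  have Uc: "U \<in> carrier_mat (p * q) (p * q)" and Vc: "V \<in> carrier_mat (p * q) (p * q)"
    using assms by (auto simp: is_tensor_commutation_mat_def permutation_mat_def)
  define e :: "nat \<Rightarrow> nat \<Rightarrow> complex mat"
    where "e n i = mat n 1 (\<lambda>(r, _). if r = i then 1 else 0)" for n i
  have ec: "e n i \<in> carrier_mat n 1" for n i by (simp add: e_def)
  have col: "(W * (e p (k div q) \<otimes>\<^sub>k e q (k mod q))) $$ (r, 0) = W $$ (r, k)"
    if W: "W \<in> carrier_mat (p * q) (p * q)" and r: "r < p * q" and k: "k < p * q" for W r k
  proof -
    have q: "q > 0" using k by (cases q) auto
    have "(W * (e p (k div q) \<otimes>\<^sub>k e q (k mod q))) $$ (r, 0)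
        = (\<Sum>l<p * q. W $$ (r, l) * (e p (k div q) \<otimes>\<^sub>k e q (k mod q)) $$ (l, 0))"
      by (rule mult_col_index[OF W kronecker_col_carrier[OF ec ec] r])
    also have "\<dots> = (\<Sum>l<p * q. if l = k then W $$ (r, l) else 0)"
    proof (rule sum.cong[OF refl])
      fix l assume "l \<in> {..<p * q}"
      hence l: "l < p * q" by simp
      have "l div q < p" using l by (simp add: less_mult_imp_div_less)
      moreover have "l = k \<longleftrightarrow> l div q = k div q \<and> l mod q = k mod q"
        by (metis div_mult_mod_eq)
      ultimately show "W $$ (r, l) * (e p (k div q) \<otimes>\<^sub>k e q (k mod q)) $$ (l, 0)
          = (if l = k then W $$ (r, l) else 0)"
        using kronecker_col_index[OF ec ec l, of "k div q" "k mod q"] q by (simp add: e_def)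
    qed
    also have "\<dots> = W $$ (r, k)" using k by simp
    finally show ?thesis .
  qed
  show ?thesis
  proof (rule eq_matI)
    fix r k assume "r < dim_row V" "k < dim_col V"
    hence r: "r < p * q" and k: "k < p * q" using Vc by auto
    have "U * (e p (k div q) \<otimes>\<^sub>k e q (k mod q)) = V * (e p (k div q) \<otimes>\<^sub>k e q (k mod q))"
      using assms ec unfolding is_tensor_commutation_mat_def by simp
    thus "U $$ (r, k) = V $$ (r, k)" using col[OF Uc r k] col[OF Vc r k] by simp
  qed (use Uc Vc in auto)
qed

lemma ex1_tensor_commutation_mat:
  assumes "p > 0" "q > 0"
  shows "\<exists>!U. is_tensor_commutation_mat p q U"
  using exists_tensor_commutation_mat[OF assms] tensor_commutation_mat_unique by blast

definition pauli1 :: "complex mat" where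
  "pauli1 = mat_of_rows_list 2 [[0, 1], [1, 0]]"

definition pauli2 :: "complex mat" where
  "pauli2 = mat_of_rows_list 2 [[0, - \<i>], [\<i>, 0]]"

definition pauli3 :: "complex mat" where
  "pauli3 = mat_of_rows_list 2 [[1, 0], [0, - 1]]"

definition gell_mann1 :: "complex mat" where
  "gell_mann1 = mat_of_rows_list 3 [[0, 1, 0], [1, 0, 0], [0, 0, 0]]"

definition gell_mann2 :: "complex mat" where
  "gell_mann2 = mat_of_rows_list 3 [[0, - \<i>, 0], [\<i>, 0, 0], [0, 0, 0]]"

definition gell_mann3 :: "complex mat" where
  "gell_mann3 = mat_of_rows_list 3 [[1, 0, 0], [0, - 1, 0], [0, 0, 0]]"

definition gell_mann4 :: "complex mat" where
  "gell_mann4 = mat_of_rows_list 3 [[0, 0, 1], [0, 0, 0], [1, 0, 0]]"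

definition gell_mann5 :: "complex mat" where
  "gell_mann5 = mat_of_rows_list 3 [[0, 0, - \<i>], [0, 0, 0], [\<i>, 0, 0]]"

definition gell_mann6 :: "complex mat" where
  "gell_mann6 = mat_of_rows_list 3 [[0, 0, 0], [0, 0, 1], [0, 1, 0]]"

definition gell_mann7 :: "complex mat" where
  "gell_mann7 = mat_of_rows_list 3 [[0, 0, 0], [0, 0, - \<i>], [0, \<i>, 0]]"

definition gell_mann8 :: "complex mat" where
  "gell_mann8 = complex_of_real (1 / sqrt 3) \<cdot>\<^sub>m mat_of_rows_list 3 [[1, 0, 0], [0, 1, 0], [0, 0, - 2]]"

end

(* With E_ij the matrix units, the definition amounts to U = (sum over i, j of E_ij \<otimes> E_ji).  The
   linear combinations of Pauli and Gell-Mann matrices on the right-hand side are such units, so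
   that comparing the 36 entries proves the formula. *)
theory Submission
  imports Defs
begin

text \<open>Division by \<open>q\<close> with remainder identifies k with the pair
  (\<open>k div q\<close>, \<open>k mod q\<close>), so exactly one entry of the product survives.
  Hence every standard basis column is decomposable, and the swap property can be applied to
  it.\<close>

lemma kronecker_unit_cols:
  assumes "k < p * q"
  shows "mat p 1 (\<lambda>(r, _). if r = k div q then 1 else 0) \<otimes>\<^sub>k mat q 1 (\<lambda>(r, _). if r = k mod q then 1 else 0)
    = mat (p * q) 1 (\<lambda>(r, _). if r = k then 1 else 0)"
proof (rule eq_matI)
  fix r c
  assume "r < dim_row (mat (p * q) 1 (\<lambda>(r, _). if r = k then 1 else (0::complex)))"
    and "c < dim_col (mat (p * q) 1 (\<lambda>(r, _). if r = k then 1 else (0::complex)))"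
  then have r: "r < p * q" and c: "c = 0" by auto
  have q: "q > 0" using r by (cases q) auto
  have "r div q < p" using r by (simp add: less_mult_imp_div_less)
  moreover have "r = k \<longleftrightarrow> r div q = k div q \<and> r mod q = k mod q"
    by (metis div_mult_mod_eq)
  ultimately show "(mat p 1 (\<lambda>(r, _). if r = k div q then 1 else 0)
      \<otimes>\<^sub>k mat q 1 (\<lambda>(r, _). if r = k mod q then 1 else 0)) $$ (r, c)
    = mat (p * q) 1 (\<lambda>(r, _). if r = k then 1 else 0) $$ (r, c)"
    using r c q by (simp add: kronecker_def)
qed (simp_all add: kronecker_def)

text \<open>Column k of a matrix is its value on the k-th basis column. That column factors as a
  tensor product, and swapping the factors gives another basis column, whose index is the row of the
  only 1.\<close>

lemma tensor_commutation_mat_eq: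
  assumes "p > 0" "q > 0"
  shows "tensor_commutation_mat p q
    = mat (p * q) (p * q) (\<lambda>(r, k). if r = (k mod q) * p + k div q then 1 else 0)" (is "?U = ?V")
proof (rule eq_matI)
  have U: "is_tensor_commutation_mat p q ?U"
    unfolding tensor_commutation_mat_def by (rule theI'[OF ex1_tensor_commutation_mat[OF assms]])
  then have Uc: "?U \<in> carrier_mat (p * q) (p * q)"
    by (auto simp: is_tensor_commutation_mat_def permutation_mat_def)
  then show "dim_row ?U = dim_row ?V" "dim_col ?U = dim_col ?V" by auto
  fix r k assume "r < dim_row ?V" "k < dim_col ?V"
  then have r: "r < p * q" and k: "k < p * q" by auto
  define e :: "nat \<Rightarrow> nat \<Rightarrow> complex mat"
    where "e n i = mat n 1 (\<lambda>(r, _). if r = i then 1 else 0)" for n i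
  have ec: "e n i \<in> carrier_mat n 1" for n i by (simp add: e_def)
  \<comment> \<open>After the swap the second factor has length p, so the new index is decoded by
    division by p instead of q.\<close>
  define k' where "k' = (k mod q) * p + k div q"
  have "k div q < p" using k by (simp add: less_mult_imp_div_less)
  moreover have "k mod q < q" using assms by simp
  ultimately have k': "k' < q * p" "k' div p = k mod q" "k' mod p = k div q"
    using tensor_index_less[of "k mod q" q "k div q" p] by (simp_all add: k'_def)
  have "?U $$ (r, k) = (\<Sum>l<p * q. if l = k then ?U $$ (r, l) else 0)" using k by simp
  also have "\<dots> = (\<Sum>l<p * q. ?U $$ (r, l) * e (p * q) k $$ (l, 0))"
    by (rule sum.cong) (auto simp: e_def)
  also have "\<dots> = (?U * e (p * q) k) $$ (r, 0)"
    by (rule mult_col_index[OF Uc ec r, symmetric])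
  also have "e (p * q) k = e p (k div q) \<otimes>\<^sub>k e q (k mod q)"
    unfolding e_def by (rule kronecker_unit_cols[OF k, symmetric])
  also have "?U * \<dots> = e q (k mod q) \<otimes>\<^sub>k e p (k div q)"
    using U ec unfolding is_tensor_commutation_mat_def by simp
  also have "\<dots> = e (q * p) k'"
    using kronecker_unit_cols[OF k'(1)] k'(2,3) unfolding e_def by simp
  finally show "?U $$ (r, k) = ?V $$ (r, k)"
    using r k by (simp add: e_def k'_def mult.commute)
qed

lemma less_6_cases:
  fixes k :: nat
  assumes "k < 6"
  obtains "k = 0" | "k = 1" | "k = 2" | "k = 3" | "k = 4" | "k = 5"
  using assms by linarith

theorem mainTheorem3:
  shows "tensor_commutation_mat 2 3 =
      ((1/2) \<cdot>\<^sub>m 1\<^sub>m 2 + (1/2) \<cdot>\<^sub>m pauli3)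
        \<otimes>\<^sub>k ((1/3) \<cdot>\<^sub>m 1\<^sub>m 3 + (1/2) \<cdot>\<^sub>m gell_mann3 + complex_of_real (sqrt 3 / 6) \<cdot>\<^sub>m gell_mann8)
    + ((1/2) \<cdot>\<^sub>m pauli1 + (\<i>/2) \<cdot>\<^sub>m pauli2)
        \<otimes>\<^sub>k ((1/2) \<cdot>\<^sub>m gell_mann1 - (\<i>/2) \<cdot>\<^sub>m gell_mann2)
    + ((1/2) \<cdot>\<^sub>m 1\<^sub>m 2 + (1/2) \<cdot>\<^sub>m pauli3)
        \<otimes>\<^sub>k ((1/2) \<cdot>\<^sub>m gell_mann6 - (\<i>/2) \<cdot>\<^sub>m gell_mann7)
    + ((1/2) \<cdot>\<^sub>m 1\<^sub>m 2 - (1/2) \<cdot>\<^sub>m pauli3)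
        \<otimes>\<^sub>k ((1/2) \<cdot>\<^sub>m gell_mann1 + (\<i>/2) \<cdot>\<^sub>m gell_mann2)
    + ((1/2) \<cdot>\<^sub>m pauli1 - (\<i>/2) \<cdot>\<^sub>m pauli2)
        \<otimes>\<^sub>k ((1/2) \<cdot>\<^sub>m gell_mann6 + (\<i>/2) \<cdot>\<^sub>m gell_mann7)
    + ((1/2) \<cdot>\<^sub>m 1\<^sub>m 2 - (1/2) \<cdot>\<^sub>m pauli3)
        \<otimes>\<^sub>k ((1/3) \<cdot>\<^sub>m 1\<^sub>m 3 - complex_of_real (sqrt 3 / 3) \<cdot>\<^sub>m gell_mann8)"
proof -
  define E :: "nat \<Rightarrow> nat \<Rightarrow> nat \<Rightarrow> complex mat"
    where "E n i j = mat n n (\<lambda>(r, c). if r = i \<and> c = j then 1 else 0)" for n i j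
  have less3: "k < 3 \<Longrightarrow> k = 0 \<or> k = 1 \<or> k = 2" and less2: "k < 2 \<Longrightarrow> k = 0 \<or> k = 1"
    for k :: nat by linarith+
  note defs = pauli1_def pauli2_def pauli3_def gell_mann1_def gell_mann2_def gell_mann3_def
    gell_mann6_def gell_mann7_def mat_of_rows_list_def E_def
  \<comment> \<open>The diagonal projections and the raising and lowering matrices, with indices
    counted from 0.\<close>
  have P: "(1/2) \<cdot>\<^sub>m 1\<^sub>m 2 + (1/2) \<cdot>\<^sub>m pauli3 = E 2 0 0"
    "(1/2) \<cdot>\<^sub>m 1\<^sub>m 2 - (1/2) \<cdot>\<^sub>m pauli3 = E 2 1 1"
    "(1/2) \<cdot>\<^sub>m pauli1 + (\<i>/2) \<cdot>\<^sub>m pauli2 = E 2 0 1"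
    "(1/2) \<cdot>\<^sub>m pauli1 - (\<i>/2) \<cdot>\<^sub>m pauli2 = E 2 1 0"
    by (rule eq_matI; auto simp: defs dest!: less2)+
  \<comment> \<open>The same raising and lowering pattern: the pair 1, 2 acts on coordinates 0 and
    1, the pair 6, 7 on coordinates 1 and 2.\<close>
  have G: "(1/2) \<cdot>\<^sub>m gell_mann1 - (\<i>/2) \<cdot>\<^sub>m gell_mann2 = E 3 1 0"
    "(1/2) \<cdot>\<^sub>m gell_mann1 + (\<i>/2) \<cdot>\<^sub>m gell_mann2 = E 3 0 1"
    "(1/2) \<cdot>\<^sub>m gell_mann6 - (\<i>/2) \<cdot>\<^sub>m gell_mann7 = E 3 2 1"
    "(1/2) \<cdot>\<^sub>m gell_mann6 + (\<i>/2) \<cdot>\<^sub>m gell_mann7 = E 3 1 2"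
    by (rule eq_matI; auto simp: defs dest!: less3)+
  \<comment> \<open>The square roots cancel here, so the remaining arithmetic is rational.\<close>
  have L: "complex_of_real (sqrt 3 / 6) \<cdot>\<^sub>m gell_mann8
      = (1/6) \<cdot>\<^sub>m mat_of_rows_list 3 [[1, 0, 0], [0, 1, 0], [0, 0, - 2]]"
    "complex_of_real (sqrt 3 / 3) \<cdot>\<^sub>m gell_mann8
      = (1/3) \<cdot>\<^sub>m mat_of_rows_list 3 [[1, 0, 0], [0, 1, 0], [0, 0, - 2]]"
    by (rule eq_matI; simp add: gell_mann8_def)+
  \<comment> \<open>On the diagonals: 1/3 + 1/2 + 1/6 = 1, 1/3 - 1/2 + 1/6 = 0 and 1/3 - 2/6 = 0;
    then 1/3 - 1/3 = 0 twice and 1/3 + 2/3 = 1.\<close>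
  have D: "(1/3) \<cdot>\<^sub>m 1\<^sub>m 3 + (1/2) \<cdot>\<^sub>m gell_mann3 + complex_of_real (sqrt 3 / 6) \<cdot>\<^sub>m gell_mann8 = E 3 0 0"
    "(1/3) \<cdot>\<^sub>m 1\<^sub>m 3 - complex_of_real (sqrt 3 / 3) \<cdot>\<^sub>m gell_mann8 = E 3 2 2"
    unfolding L by (rule eq_matI; auto simp: defs dest!: less3)+
  \<comment> \<open>Each summand is now a 6 by 6 matrix unit. In the order of the statement they
    occupy rows 0 to 5 and columns 0, 3, 1, 4, 2, 5. Rows are read here as 2 blocks of 3, whereas
    the swapped product groups them as 3 blocks of 2; this is why the two factors of a summand need
    not have transposed indices.\<close>
  show ?thesis
    unfolding P G D
  proof (rule eq_matI, goal_cases)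
    case (1 r c)
    then have "r < 6" "c < 6" by (simp_all add: kronecker_def E_def)
    then show ?case
      by (elim less_6_cases) (simp_all add: tensor_commutation_mat_eq kronecker_def E_def)
  qed (simp_all add: tensor_commutation_mat_eq kronecker_def E_def)
qed

end
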